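(* Let $m$ be a positive integer and let $h$ be a positive divisor of $m$ such that $m/h$ is even and $m/h>2$. Write $m=2e$. Put $q=2^m$, $D_1=\{x\in\mathbb{F}_q^*:\mathrm{Tr}(x)=1\}$ and $$\mathcal{C}_{D_1}=\left\{\left(\mathrm{Tr}(x d^{2^h+1})\right)_{d\in D_1}: x\in\mathbb{F}_q\right\}.$$ Then $\mathcal{C}_{D_1}$ is a $[2^{m-1},\,m]$ binary linear code whose weight distribution is as follows: there is exactly $1$ codeword of weight $0$; the number of codewords of weight $2^{m-2}+(-1)^{\frac{e}{h}}2^{e+h-1}$ is $$\frac{2^{m-2h-1}+(-1)^{\frac{e}{h}}2^{e-h-1}}{2^h+1};$$ the number of codewords of weight $2^{m-2}+(-1)^{\frac{e}{h}}2^{e+h-2}$ is $(2^h-1)2^{m-2h}$; the number of codewords of weight $2^{m-2}$ is $$2^{m-1}-1+(-1)^{\frac{e}{h}}2^{e-h-1}(2^h-1)-(2^h-1)2^{m-2h-1};$$ the number of codewords of weight $2^{m-2}-(-1)^{\frac{e}{h}}2^{e-1}$ is $$\frac{\left(2^e-(-1)^{\frac{e}{h}}\right)2^{e+h-1}}{2^h+1};$$ and there are no codewords of any other weight.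
   Context: $\mathbb{F}_q$ is the finite field with $q=2^m$ elements, $\mathbb{F}_q^*$ its multiplicative group, and $\mathrm{Tr}:\mathbb{F}_q\to\mathbb{F}_2$ is the absolute trace. An $[n,k]$ binary linear code is a $k$-dimensional $\mathbb{F}_2$-subspace of $\mathbb{F}_2^n$; the (Hamming) weight of a codeword is its number of nonzero coordinates; the weight distribution records, for each $i$, the number of codewords of weight $i$. *)

theory Defs
  imports "HOL-Library.Cardinality" "HOL-Library.Z2" "HOL-Library.Function_Algebras" "HOL-Number_Theory.Number_Theory"
begin

text \<open>
  The field of two elements is \<^typ>\<open>bit\<close>. A vector whose coordinates are indexed by a set \<open>I\<close>
  is a function into \<^typ>\<open>bit\<close> that is 0 outside \<open>I\<close>; such functions form
  a copy of the space of binary vectors of length \<open>card I\<close>, without a choice of an ordering of \<open>I\<close>.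
\<close>

definition F2_space :: "'i set \<Rightarrow> ('i \<Rightarrow> bit) set" where
  "F2_space I = {v. \<forall>i. i \<notin> I \<longrightarrow> v i = 0}"

definition F2_scale :: "bit \<Rightarrow> ('i \<Rightarrow> bit) \<Rightarrow> 'i \<Rightarrow> bit" where
  "F2_scale c v = (\<lambda>i. c * v i)"

global_interpretation F2: vector_space "F2_scale :: bit \<Rightarrow> ('i \<Rightarrow> bit) \<Rightarrow> 'i \<Rightarrow> bit"
  by unfold_locales (auto simp: F2_scale_def fun_eq_iff algebra_simps)

definition binary_linear_code :: "'i set \<Rightarrow> nat \<Rightarrow> nat \<Rightarrow> ('i \<Rightarrow> bit) set \<Rightarrow> bool" where
  "binary_linear_code I n k C \<longleftrightarrow>
     finite I \<and> card I = n \<and> C \<subseteq> F2_space I \<and> F2.subspace C \<and> F2.dim C = k"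

definition hamming_weight :: "('i \<Rightarrow> bit) \<Rightarrow> nat" where
  "hamming_weight v = card {i. v i \<noteq> 0}"

text \<open>The weight is an integer argument so that formulas with signs can be used for it.\<close>

definition weight_count :: "('i \<Rightarrow> bit) set \<Rightarrow> int \<Rightarrow> nat" where
  "weight_count C w = card {v \<in> C. int (hamming_weight v) = w}"

text \<open>
  The absolute trace of the field with \<open>2 ^ m\<close> elements is the sum of the \<open>m\<close> conjugates of \<open>x\<close>
  over the prime field. That sum is 0 or 1 in the big field (lemma \<open>abs_trace_embed\<close> below), and
  the trace is the corresponding element of \<^typ>\<open>bit\<close>.
\<close>

definition F2_embed :: "bit \<Rightarrow> 'a::finite_field" where
  "F2_embed b = of_bool (b = 1)"

definition abs_trace :: "nat \<Rightarrow> 'a::finite_field \<Rightarrow> bit" where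
  "abs_trace m x = (THE b. F2_embed b = (\<Sum>i<m. x ^ (2 ^ i)))"

lemma abs_trace_embed:
  fixes x :: "'a::finite_field"
  assumes card: "CARD('a) = 2 ^ m"
  shows "F2_embed (abs_trace m x) = (\<Sum>i<m. x ^ (2 ^ i))"
proof -
  let ?s = "\<Sum>i<m. x ^ (2 ^ i)"
  have "CHAR('a) dvd 2 ^ m"
    using CHAR_dvd_CARD[where 'a = 'a] card by simp
  then have "CHAR('a) dvd 2"
    using CHAR_prime[where 'a = 'a] prime_dvd_power by blast
  then have char: "CHAR('a) = 2"
    using CHAR_prime[where 'a = 'a] primes_dvd_imp_eq two_is_prime_nat by blast
  have "?s ^ 2 = (\<Sum>i<m. (x ^ (2 ^ i)) ^ 2)"
    by (rule freshmans_dream_sum) (simp_all add: char)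
  also have "\<dots> = (\<Sum>i<m. x ^ (2 ^ Suc i))"
    by (simp add: power_mult [symmetric] mult.commute)
  also have "\<dots> = ?s + x ^ (2 ^ m) - x"
    using sum.lessThan_Suc_shift[of "\<lambda>i. x ^ (2 ^ i)" m]
      sum.lessThan_Suc[of "\<lambda>i. x ^ (2 ^ i)" m] by (simp add: algebra_simps)
  also have "\<dots> = ?s"
    using finite_field_power_card_eq_same[of x] card by simp
  finally have "?s * ?s = ?s * 1"
    by (simp add: power2_eq_square)
  then have "?s = 0 \<or> ?s = 1"
    by (metis mult_left_cancel)
  then have "\<exists>!b. F2_embed b = ?s"
    by (auto simp: F2_embed_def)
  then show ?thesis
    unfolding abs_trace_def by (rule theI')
qed

definition D1 :: "nat \<Rightarrow> 'a::finite_field set" where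
  "D1 m = {x. x \<noteq> 0 \<and> abs_trace m x = 1}"

definition code_D1 :: "nat \<Rightarrow> nat \<Rightarrow> ('a::finite_field \<Rightarrow> bit) set" where
  "code_D1 m h =
     range (\<lambda>x d. if d \<in> D1 m then abs_trace m (x * d ^ (2 ^ h + 1)) else 0)"

end

theory Submission
  imports Defs "HOL-Computational_Algebra.Polynomial"
begin

text \<open>
  Let \<open>\<chi> = (-1)\<close> to the power \<open>Tr\<close>, \<open>n = 2^h + 1\<close>, \<open>\<epsilon> = (-1)^(e/h)\<close>
  and \<open>W(a, b) = \<Sum>\<^sub>x \<chi>(a x^n + b x)\<close>. The codeword of \<open>a \<noteq> 0\<close> has weight
  \<open>(2^m - W(a, 0) + W(a, 1)) / 4\<close>. Expanding the square, \<open>W(a, b)^2\<close> is \<open>2^m\<close> times a sum over the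
  radical of the quadratic form \<open>Tr(a x^n)\<close>. The radical is trivial if \<open>a\<close> is not an \<open>n\<close>-th power; for \<open>a = 1\<close>
  it is the subfield with \<open>2^(2h)\<close> elements, and the form vanishes on it. This gives the
  absolute values. The sign of \<open>W(a, 0)\<close> is forced by \<open>W(a, 0) \<equiv> 1 (mod n)\<close>, since nonzero
  elements with the same \<open>n\<close>-th power come in groups of \<open>n\<close>, together with \<open>2^e \<equiv> \<epsilon> (mod n)\<close>.
  Finally \<open>W(c^n, 1) = W(1, 1/c)\<close>, and the first and second moments of \<open>W(1, b)\<close> over \<open>b\<close> and the
  first moment of \<open>W(a, 1)\<close> over \<open>a\<close> determine how often each value occurs.
\<close>

section \<open>Powers in finite fields\<close>

lemma finite_field_char_two:
  assumes "CARD('a::finite_field) = 2 ^ m"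
  shows "CHAR('a) = 2"
proof -
  have "CHAR('a) dvd 2 ^ m"
    using CHAR_dvd_CARD[where 'a = 'a] assms by simp
  then have "CHAR('a) dvd 2"
    using CHAR_prime[where 'a = 'a] prime_dvd_power by blast
  then show ?thesis
    using CHAR_prime[where 'a = 'a] primes_dvd_imp_eq two_is_prime_nat by blast
qed

lemma card_power_eq_le:
  fixes c :: "'a::idom"
  assumes "k > 0"
  shows "card {x. x ^ k = c} \<le> k" "finite {x. x ^ k = c}"
proof -
  let ?p = "Polynomial.monom 1 k + [:- c:]"
  have deg: "Polynomial.degree ?p = k"
    using assms by (subst degree_add_eq_left) (auto simp: Polynomial.degree_monom_eq)
  then have "?p \<noteq> 0" using assms by auto
  moreover have "{x. x ^ k = c} = {x. poly ?p x = 0}"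
    by (auto simp: poly_monom)
  ultimately show "card {x. x ^ k = c} \<le> k" "finite {x. x ^ k = c}"
    using card_poly_roots_bound[of ?p] poly_roots_finite[of ?p] deg by auto
qed

lemma finite_field_card_gt_one: "CARD('a::finite_field) > 1"
  using card_mono[of UNIV "{0, 1::'a}"] by simp

lemma finite_field_power_card_minus_one:
  fixes x :: "'a::finite_field"
  assumes "x \<noteq> 0"
  shows "x ^ (CARD('a) - 1) = 1"
proof -
  have "x * x ^ (CARD('a) - 1) = x * 1"
    using finite_field_power_card_eq_same[of x] finite_field_card_gt_one[where 'a='a]
    by (simp flip: power_Suc)
  then show ?thesis using assms by simp
qed

text \<open>With \<open>k * j = q - 1\<close>, the map \<open>x ^ j\<close> sends the nonzero
  elements into the \<open>k\<close>-th roots of unity, and each fibre has at most \<open>j\<close>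
  elements, so there are at least \<open>k\<close> roots. The degree bound gives the converse,
  without cyclicity of the multiplicative group.\<close>

lemma card_roots_of_unity_finite_field:
  assumes "k dvd CARD('a::finite_field) - 1"
  shows "card {x::'a. x ^ k = 1} = k"
proof -
  obtain j where j: "CARD('a) - 1 = k * j" using assms by auto
  have "k > 0" "j > 0"
    using j finite_field_card_gt_one[where 'a='a] by (auto intro: Nat.gr0I)
  let ?N = "UNIV - {0::'a}" and ?R = "{x::'a. x ^ k = 1}"
  have "(x ^ j) ^ k = 1" if "x \<noteq> 0" for x :: 'a
    using that j finite_field_power_card_minus_one[of x]
    by (simp add: power_mult[symmetric] mult.commute)
  then have "?N \<subseteq> (\<Union>y\<in>?R. {x. x ^ j = y})" by auto
  then have "card ?N \<le> card (\<Union>y\<in>?R. {x. x ^ j = y})"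
    by (intro card_mono) auto
  also have "\<dots> \<le> (\<Sum>y\<in>?R. card {x. x ^ j = y})"
    by (rule card_UN_le) auto
  also have "\<dots> \<le> (\<Sum>y\<in>?R. j)"
    using card_power_eq_le[OF \<open>j > 0\<close>] by (intro sum_mono) auto
  finally have "k * j \<le> card ?R * j" using j by (simp add: card_Diff_singleton)
  then have "k \<le> card ?R" using \<open>j > 0\<close> by simp
  then show ?thesis using card_power_eq_le(1)[OF \<open>k > 0\<close>, of "1::'a"] by simp
qed

lemma card_power_fibre_finite_field:
  fixes c :: "'a::finite_field"
  assumes "k dvd CARD('a) - 1" "c \<noteq> 0"
  shows "card {x. x ^ k = c ^ k} = k"
proof -
  have "k > 0"
    using assms(1) finite_field_card_gt_one[where 'a='a] by (cases k) auto
  have "bij_betw (\<lambda>x. c * x) {x. x ^ k = 1} {x. x ^ k = c ^ k}"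
    using assms(2)
    by (intro bij_betw_byWitness[where f' = "\<lambda>x. x / c"]) (auto simp: field_simps power_mult_distrib)
  then show ?thesis
    using bij_betw_same_card card_roots_of_unity_finite_field[OF assms(1)] by fastforce
qed

text \<open>The \<open>k\<close>-th power map is \<open>k\<close>-to-one on nonzero elements. Sums
  over the set of powers thereby become sums over all nonzero \<open>c\<close>, where substitutions
  are possible.\<close>

lemma sum_power_image_finite_field:
  fixes g :: "'a::finite_field \<Rightarrow> 'b::semiring_1"
  assumes "k dvd CARD('a) - 1"
  shows "(\<Sum>c\<in>UNIV - {0}. g (c ^ k)) = of_nat k * (\<Sum>a\<in>(\<lambda>c. c ^ k) ` (UNIV - {0}). g a)"
proof -
  let ?S = "UNIV - {0::'a}"
  have "k > 0"
    using assms finite_field_card_gt_one[where 'a='a] by (cases k) auto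
  have "(\<Sum>c\<in>?S. g (c ^ k)) = (\<Sum>a\<in>(\<lambda>c. c ^ k) ` ?S. \<Sum>c\<in>{c \<in> ?S. c ^ k = a}. g (c ^ k))"
    by (rule sum.group[symmetric]) auto
  also have "\<dots> = (\<Sum>a\<in>(\<lambda>c. c ^ k) ` ?S. of_nat k * g a)"
  proof (rule sum.cong[OF refl])
    fix a assume "a \<in> (\<lambda>c. c ^ k) ` ?S"
    then obtain c where c: "a = c ^ k" "c \<noteq> 0" by auto
    then have "{c \<in> ?S. c ^ k = a} = {x. x ^ k = c ^ k}"
      using \<open>k > 0\<close> by (auto simp: zero_power)
    then show "(\<Sum>c\<in>{c \<in> ?S. c ^ k = a}. g (c ^ k)) = of_nat k * g a"
      using card_power_fibre_finite_field[OF assms c(2)] c by simp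
  qed
  finally show ?thesis by (simp add: sum_distrib_left)
qed

lemma card_power_image_finite_field:
  fixes P :: "'a::finite_field \<Rightarrow> bool"
  assumes "k dvd CARD('a) - 1"
  shows "k * card {a \<in> (\<lambda>c. c ^ k) ` (UNIV - {0}). P a} = card {c. c \<noteq> 0 \<and> P (c ^ k)}"
  using sum_power_image_finite_field[OF assms, of "\<lambda>a. of_bool (P a) :: nat"]
  by (simp add: sum_of_bool_eq Int_def)

lemma power_minus_one_dvd:
  fixes a :: nat
  assumes "d dvd n"
  shows "a ^ d - 1 dvd a ^ n - 1"
proof (cases "a = 0")
  case False
  obtain k where "n = d * k" using assms by auto
  have "int (a ^ d) - 1 dvd int (a ^ d) ^ k - 1"
    using cong_pow[of "int (a ^ d)" 1 "int (a ^ d) - 1" k] by (simp add: cong_iff_dvd_diff)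
  then have "int (a ^ d - 1) dvd int (a ^ n - 1)"
    using False \<open>n = d * k\<close> by (simp add: of_nat_diff power_mult)
  then show ?thesis by (simp only: of_nat_dvd_iff)
qed (use assms in \<open>auto simp: power_0_left\<close>)

section \<open>Dimension of a finite binary space\<close>

text \<open>The only scalars are 0 and 1, so adjoining \<open>b\<close> adds just the translate of
  the old span by \<open>b\<close>. Independence makes it disjoint from the old span, and the size
  doubles.\<close>

lemma F2_card_span:
  assumes "finite B" "F2.independent B"
  shows "card (F2.span B) = 2 ^ card B"
  using assms
proof (induction B)
  case (insert b B)
  then have ind: "F2.independent B" "b \<notin> F2.span B"
    by (auto simp: F2.independent_insert)
  have un: "F2.span (insert b B) = F2.span B \<union> (\<lambda>v. v + b) ` F2.span B" (is "?L = ?R")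
  proof (intro equalityI subsetI)
    fix x assume "x \<in> ?L"
    then obtain k where k: "x - F2_scale k b \<in> F2.span B" by (auto simp: F2.span_insert)
    show "x \<in> ?R"
    proof (cases k)
      case zero
      then show ?thesis using k by (simp add: F2_scale_def zero_fun_def[symmetric])
    next
      case one
      then have "x - b \<in> F2.span B" using k by (metis F2.scale_one)
      then have "x - b + b \<in> (\<lambda>v. v + b) ` F2.span B" by blast
      then show ?thesis by simp
    qed
  next
    fix x assume "x \<in> ?R"
    then show "x \<in> ?L"
      by (auto intro: F2.span_base F2.span_add subsetD[OF F2.span_mono[of B "insert b B"]])
  qed
  have "F2.span B \<inter> (\<lambda>v. v + b) ` F2.span B = {}"
  proof (rule ccontr)
    assume "F2.span B \<inter> (\<lambda>v. v + b) ` F2.span B \<noteq> {}"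
    then obtain v where "v \<in> F2.span B" "v + b \<in> F2.span B" by auto
    then have "v + b - v \<in> F2.span B" by (intro F2.span_diff)
    then show False using ind by simp
  qed
  moreover have fin: "finite (F2.span B)" using insert.IH ind by (intro card_ge_0_finite) simp
  moreover have "card ((\<lambda>v. v + b) ` F2.span B) = card (F2.span B)"
    by (rule card_image) simp
  ultimately show ?case
    using insert ind by (simp add: un card_Un_disjoint)
qed simp

lemma F2_dim_eqI:
  assumes "F2.subspace V" "finite V" "card V = 2 ^ k"
  shows "F2.dim V = k"
proof -
  obtain B where B: "B \<subseteq> V" "F2.independent B" "V \<subseteq> F2.span B" "card B = F2.dim V"
    using F2.basis_exists by blast
  have "F2.span B = V" using B F2.span_minimal[OF B(1) assms(1)] by auto
  then have "2 ^ k = (2 ^ F2.dim V :: nat)"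
    using F2_card_span[OF finite_subset[OF B(1) assms(2)] B(2)] B(4) assms(3) by simp
  then show ?thesis by simp
qed

section \<open>The quadratic exponential sums\<close>

definition chi :: "nat \<Rightarrow> 'a::finite_field \<Rightarrow> int" where
  "chi m x = (if abs_trace m x = 0 then 1 else -1)"

definition weil_sum :: "nat \<Rightarrow> nat \<Rightarrow> 'a::finite_field \<Rightarrow> 'a \<Rightarrow> int" where
  "weil_sum m n a b = (\<Sum>x\<in>UNIV. chi m (a * x ^ n + b * x))"

section \<open>Characteristic two, the trace and its additive character\<close>

context
  fixes m :: nat
  assumes card_UNIV: "CARD('a::finite_field) = 2 ^ m"
begin

lemma degree_pos: "m > 0"
  using finite_field_card_gt_one[where 'a='a] card_UNIV by (cases m) auto

lemma char_two: "CHAR('a) = 2"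
  using finite_field_char_two[OF card_UNIV] .

lemma char_two_two_eq_zero: "(2::'a) = 0"
  using of_nat_CHAR[where 'a='a] char_two by simp

lemma char_two_add_self: "x + x = (0::'a)"
  by (metis mult_2 mult_zero_left char_two_two_eq_zero)

lemma char_two_add_eq_zero_iff: "x + y = (0::'a) \<longleftrightarrow> x = y"
  using uminus_CHAR_2[OF char_two] by (metis add_eq_0_iff2)

lemma char_two_power_add: "(x + y :: 'a) ^ (2 ^ k) = x ^ (2 ^ k) + y ^ (2 ^ k)"
  by (rule freshmans_dream') (use char_two in simp_all)

lemma finite_field_power_two_power: "(x::'a) ^ (2 ^ m) = x"
  using finite_field_power_card_eq_same[of x] card_UNIV by simp

lemma F2_embed_inj: "(F2_embed b :: 'a) = F2_embed c \<longleftrightarrow> b = c"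
  by (cases b; cases c) (auto simp: F2_embed_def)

lemma F2_embed_add: "F2_embed (b + c) = (F2_embed b + F2_embed c :: 'a)"
  by (cases b; cases c) (auto simp: F2_embed_def char_two_two_eq_zero)

lemma trace_add: "abs_trace m (x + y :: 'a) = abs_trace m x + abs_trace m y"
  by (simp only: F2_embed_inj [symmetric] F2_embed_add abs_trace_embed[OF card_UNIV]
      char_two_power_add sum.distrib)

lemma trace_zero: "abs_trace m (0 :: 'a) = 0"
  using trace_add[of 0 0] by simp

lemma trace_square: "abs_trace m ((x::'a) ^ 2) = abs_trace m x"
proof -
  have "(\<Sum>i<m. (x\<^sup>2) ^ (2 ^ i)) = (\<Sum>i<m. x ^ (2 ^ Suc i))"
    by (simp add: power_mult [symmetric] mult.commute)
  also have "\<dots> = (\<Sum>i<m. x ^ (2 ^ i))"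
    using sum.lessThan_Suc_shift[of "\<lambda>i. x ^ (2 ^ i)" m]
      sum.lessThan_Suc[of "\<lambda>i. x ^ (2 ^ i)" m] finite_field_power_two_power[of x] by (simp add: algebra_simps)
  finally show ?thesis
    by (subst F2_embed_inj [symmetric]) (simp add: abs_trace_embed[OF card_UNIV])
qed

lemma trace_power2k: "abs_trace m ((x::'a) ^ (2 ^ k)) = abs_trace m x"
proof (induction k)
  case (Suc k)
  have "x ^ (2 ^ Suc k) = (x ^ (2 ^ k)) ^ 2" by (simp add: power_mult[symmetric] mult.commute)
  then show ?case using Suc trace_square by metis
qed simp

text \<open>The trace is given by a polynomial of degree at most \<open>2 ^ (m - 1)\<close> whose
  coefficient at degree 1 is 1. A nonzero polynomial of this degree cannot vanish at all
  \<open>2 ^ m\<close> points.\<close>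

lemma trace_nontrivial: "\<exists>x::'a. abs_trace m x = 1"
proof (rule ccontr)
  assume "\<not> ?thesis"
  then have zero: "abs_trace m x = 0" for x :: 'a
    by (metis bit_not_one_iff)
  let ?p = "\<Sum>i<m. Polynomial.monom (1::'a) (2 ^ i)"
  have "poly ?p x = 0" for x
    using abs_trace_embed[OF card_UNIV, of x] zero[of x]
    by (simp add: poly_sum poly_monom F2_embed_def)
  then have *: "{x. poly ?p x = 0} = UNIV" by auto
  have "Polynomial.coeff ?p 1 = (\<Sum>i<m. if i = 0 then 1 else 0)"
    by (auto simp: coeff_sum intro!: sum.cong)
  also have "\<dots> = 1" using degree_pos by simp
  finally have "?p \<noteq> 0" by auto
  have "Polynomial.degree ?p \<le> 2 ^ (m - 1)"
    by (intro degree_sum_le) (auto intro!: order.trans[OF degree_monom_le] power_increasing)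
  then have "2 ^ m \<le> (2 ^ (m - 1) :: nat)"
    using card_poly_roots_bound[OF \<open>?p \<noteq> 0\<close>] unfolding * card_UNIV by (rule order.trans[rotated])
  then show False using degree_pos by (simp add: power_increasing_iff)
qed

lemma chi_add: "chi m (x + y :: 'a) = chi m x * chi m y"
  by (cases "abs_trace m x"; cases "abs_trace m y") (auto simp: chi_def trace_add)

lemma chi_zero: "chi m (0::'a) = 1"
  by (simp add: chi_def trace_zero)

lemma chi_power2k: "chi m ((x::'a) ^ (2 ^ k)) = chi m x"
  by (simp add: chi_def trace_power2k)

lemma chi_square: "chi m x * chi m x = 1"
  by (simp add: chi_def)

text \<open>Orthogonality: translation by a \<open>y\<close> of \<open>H\<close> with character
  value -1 permutes \<open>H\<close> and negates the sum. Closure under addition makes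
  \<open>H\<close> a subgroup, since \<open>- x = x\<close>.\<close>

lemma sum_chi_mult_subgroup:
  fixes b :: 'a
  assumes "0 \<in> H" and closed: "\<And>x y. x \<in> H \<Longrightarrow> y \<in> H \<Longrightarrow> x + y \<in> H"
  shows "(\<Sum>x\<in>H. chi m (b * x)) = (if \<forall>x\<in>H. chi m (b * x) = 1 then int (card H) else 0)"
proof (cases "\<forall>x\<in>H. chi m (b * x) = 1")
  case False
  then obtain y where y: "y \<in> H" "chi m (b * y) = -1" by (auto simp: chi_def split: if_splits)
  have "bij_betw (\<lambda>x. x + y) H H"
    by (rule bij_betw_byWitness[where f' = "\<lambda>x. x + y"])
       (use closed y in \<open>auto simp: add.assoc char_two_add_self\<close>)
  then have "(\<Sum>x\<in>H. chi m (b * x)) = (\<Sum>x\<in>H. chi m (b * (x + y)))"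
    using sum.reindex_bij_betw[of "\<lambda>x. x + y" H H "\<lambda>x. chi m (b * x)"] by simp
  also have "\<dots> = - (\<Sum>x\<in>H. chi m (b * x))"
    by (simp add: chi_add distrib_left y(2) sum_negf)
  finally show ?thesis unfolding if_not_P[OF False] by simp
qed simp

lemma sum_chi_mult: "(\<Sum>x\<in>UNIV. chi m (b * x :: 'a)) = (if b = 0 then 2 ^ m else 0)"
proof (cases "b = 0")
  case False
  obtain z :: 'a where z: "abs_trace m z = 1" using trace_nontrivial by auto
  then have "chi m (b * (z / b)) \<noteq> 1" using False by (simp add: chi_def)
  then have "\<not> (\<forall>x\<in>UNIV. chi m (b * x) = 1)" by blast
  then show ?thesis using False by (subst sum_chi_mult_subgroup) auto
qed (simp add: chi_zero card_UNIV)

text \<open>The indicator of \<open>D1 m\<close> is \<open>(1 - chi m x) / 2\<close>, and the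
  character sums to 0 over the field.\<close>

lemma card_D1: "card (D1 m :: 'a set) = 2 ^ (m - 1)"
proof -
  have "(\<Sum>x\<in>UNIV. chi m (x::'a)) = (\<Sum>x\<in>(UNIV::'a set). 1 - 2 * of_bool (x \<in> D1 m))"
    by (intro sum.cong) (auto simp: chi_def D1_def trace_zero)
  also have "\<dots> = 2 ^ m - 2 * int (card (D1 m :: 'a set))"
    by (simp add: sum_subtractf card_UNIV flip: sum_distrib_left)
  finally have "2 ^ m = 2 * int (card (D1 m :: 'a set))"
    using sum_chi_mult[of 1] by simp
  moreover have "(2::int) ^ m = 2 * 2 ^ (m - 1)"
    using degree_pos by (cases m) auto
  ultimately have "int (card (D1 m :: 'a set)) = int (2 ^ (m - 1))" by simp
  then show ?thesis by (simp only: of_nat_eq_iff)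
qed

lemma bij_char_two_power: "bij (\<lambda>x::'a. x ^ (2 ^ k))"
proof -
  have "inj (\<lambda>x::'a. x ^ (2 ^ k))"
  proof (rule injI)
    fix x y :: 'a assume "x ^ (2 ^ k) = y ^ (2 ^ k)"
    then have "(x + y) ^ (2 ^ k) = 0" by (simp add: char_two_power_add char_two_add_self)
    then show "x = y" by (simp add: char_two_add_eq_zero_iff)
  qed
  then show ?thesis by (simp add: bij_def finite_UNIV_inj_surj)
qed

end

text \<open>Resolves the sign left open by a square: if \<open>w = - s\<close>, then 1 and -1 would
  be congruent modulo \<open>k\<close>, forcing \<open>k\<close> to divide 2.\<close>

lemma int_eq_of_square_eq_cong_one:
  fixes w s k :: int
  assumes "w ^ 2 = s ^ 2" "[w = 1] (mod k)" "[s = 1] (mod k)" "k > 2"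
  shows "w = s"
proof (rule ccontr)
  assume "w \<noteq> s"
  then have "w = - s" using assms(1) by (simp add: power2_eq_iff)
  then have "w - 1 + (s - 1) = -2" by simp
  moreover have "k dvd w - 1 + (s - 1)"
    using assms(2,3) unfolding cong_iff_dvd_diff by (rule dvd_add)
  ultimately have "k dvd 2" by (metis dvd_minus_iff)
  then show False using assms(4) zdvd_imp_le by fastforce
qed

lemma power_multiple_cong_minus_one:
  "[2 ^ (h * k) = (-1) ^ k] (mod (2 ^ h + 1 :: int))"
proof -
  have "[2 ^ h = -1] (mod (2 ^ h + 1 :: int))" by (simp add: cong_iff_dvd_diff)
  then show ?thesis using cong_pow[of "2 ^ h" "-1 :: int" "2 ^ h + 1" k] by (simp add: power_mult)
qed

text \<open>The first moment gives the difference of the frequencies of \<open>s\<close> and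
  \<open>- s\<close>, the second their sum, and the cardinality then the frequency of 0.\<close>

lemma sum_three_values:
  fixes g :: "'b \<Rightarrow> int"
  assumes "finite A" "\<And>x. x \<in> A \<Longrightarrow> g x = s \<or> g x = - s \<or> g x = 0" "s \<noteq> 0"
  shows "(\<Sum>x\<in>A. g x) = s * (int (card {x\<in>A. g x = s}) - int (card {x\<in>A. g x = - s}))"
    "(\<Sum>x\<in>A. (g x) ^ 2) = s ^ 2 * (int (card {x\<in>A. g x = s}) + int (card {x\<in>A. g x = - s}))"
    "card A = card {x\<in>A. g x = s} + card {x\<in>A. g x = - s} + card {x\<in>A. g x = 0}"
proof -
  have card: "int (card {x\<in>A. P x}) = (\<Sum>x\<in>A. of_bool (P x))" for P
    using assms(1) by (simp add: sum_of_bool_eq Int_def)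
  show "(\<Sum>x\<in>A. g x) = s * (int (card {x\<in>A. g x = s}) - int (card {x\<in>A. g x = - s}))"
    unfolding card sum_subtractf[symmetric] sum_distrib_left
    by (intro sum.cong) (use assms in auto)
  show "(\<Sum>x\<in>A. (g x) ^ 2) = s ^ 2 * (int (card {x\<in>A. g x = s}) + int (card {x\<in>A. g x = - s}))"
    unfolding card sum.distrib[symmetric] sum_distrib_left
    by (intro sum.cong) (use assms in auto)
  have "int (card A) = (\<Sum>x\<in>A. 1)" by simp
  also have "\<dots> = int (card {x\<in>A. g x = s}) + int (card {x\<in>A. g x = - s}) + int (card {x\<in>A. g x = 0})"
    unfolding card sum.distrib[symmetric]
    by (intro sum.cong) (use assms in auto)
  finally show "card A = card {x\<in>A. g x = s} + card {x\<in>A. g x = - s} + card {x\<in>A. g x = 0}"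
    by (simp only: of_nat_eq_iff flip: of_nat_add)
qed

text \<open>This is the radical of the polar form of \<open>Tr(a x^(2^h + 1))\<close>, namely of
  \<open>Tr(a (z^(2^h) y + z y^(2^h)))\<close>. Raising the first term to the power
  \<open>2 ^ h\<close> under the trace turns the form into the trace of the displayed expression
  times \<open>y^(2^h)\<close>, and \<open>y^(2^h)\<close> takes every value.\<close>

definition weil_radical :: "nat \<Rightarrow> 'a::finite_field \<Rightarrow> 'a set" where
  "weil_radical h a = {z. a ^ (2 ^ h) * z ^ (2 ^ (2 * h)) + a * z = 0}"

section \<open>Squares and moments of the exponential sums\<close>

context
  fixes m :: nat
  assumes card_UNIV: "CARD('a::finite_field) = 2 ^ m"
begin

lemma chi_power2k_cancel: "x ^ (2 ^ k) = y \<Longrightarrow> chi m x = chi m (y::'a)"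
  using chi_power2k[OF card_UNIV, of x k] by simp

lemma weil_sum_square:
  fixes a b :: 'a
  shows "(weil_sum m (2 ^ h + 1) a b) ^ 2 =
    2 ^ m * (\<Sum>z\<in>weil_radical h a. chi m (a * z ^ (2 ^ h + 1) + b * z))"
proof -
  let ?f = "\<lambda>x. a * x ^ (2 ^ h + 1) + b * x"
  let ?L = "\<lambda>z. a ^ (2 ^ h) * z ^ (2 ^ (2 * h)) + a * z"
  \<comment> \<open>The product at \<open>z + y\<close> and \<open>y\<close> leaves two cross terms.
    The trace is invariant under the \<open>2 ^ h\<close>-th power, so both can be written as
    multiples of \<open>y ^ (2 ^ h)\<close>.\<close>
  have *: "chi m (?f (z + y)) * chi m (?f y) = chi m (?f z) * chi m (?L z * y ^ (2 ^ h))" for y z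
  proof -
    have "chi m (a * z ^ (2 ^ h) * y) = chi m (a ^ (2 ^ h) * z ^ (2 ^ (2 * h)) * y ^ (2 ^ h))"
      by (rule chi_power2k_cancel[where k = h])
         (simp add: power_mult_distrib mult_2 power_add flip: power_mult)
    moreover have "?f (z + y) = ?f z + ?f y + a * z ^ (2 ^ h) * y + a * z * y ^ (2 ^ h)"
      by (simp add: char_two_power_add[OF card_UNIV] algebra_simps)
    then have "chi m (?f (z + y)) * chi m (?f y) =
      chi m (?f z) * (chi m (?f y) * chi m (?f y)) * chi m (a * z ^ (2 ^ h) * y) * chi m (a * z * y ^ (2 ^ h))"
      by (simp only: chi_add[OF card_UNIV] mult.assoc mult.commute mult.left_commute)
    moreover have "chi m (?L z * y ^ (2 ^ h)) =
      chi m (a ^ (2 ^ h) * z ^ (2 ^ (2 * h)) * y ^ (2 ^ h)) * chi m (a * z * y ^ (2 ^ h))"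
      by (simp only: distrib_right chi_add[OF card_UNIV])
    ultimately show ?thesis
      by (simp only: chi_square[OF card_UNIV] mult_1_right mult.assoc)
  qed
  have reindex: "(\<Sum>y\<in>UNIV. chi m (c * y ^ (2 ^ h))) = (\<Sum>y\<in>UNIV. chi m (c * y))" for c :: 'a
    using sum.reindex_bij_betw[OF bij_char_two_power[OF card_UNIV, of h], of "\<lambda>y. chi m (c * y)"] .
  have "(weil_sum m (2 ^ h + 1) a b) ^ 2 = (\<Sum>y\<in>UNIV. \<Sum>x\<in>UNIV. chi m (?f x) * chi m (?f y))"
    by (simp only: weil_sum_def power2_eq_square sum_product) (rule sum.swap)
  also have "\<dots> = (\<Sum>y\<in>UNIV. \<Sum>z\<in>UNIV. chi m (?f (z + y)) * chi m (?f y))"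
  proof (rule sum.cong[OF refl])
    fix y :: 'a
    have "bij (\<lambda>z. z + y)"
      by (rule bij_betw_byWitness[where f' = "\<lambda>x. x - y"]) auto
    from sum.reindex_bij_betw[OF this, of "\<lambda>x. chi m (?f x) * chi m (?f y)"]
    show "(\<Sum>x\<in>UNIV. chi m (?f x) * chi m (?f y)) = (\<Sum>z\<in>UNIV. chi m (?f (z + y)) * chi m (?f y))"
      by (rule sym)
  qed
  also have "\<dots> = (\<Sum>z\<in>UNIV. \<Sum>y\<in>UNIV. chi m (?f z) * chi m (?L z * y ^ (2 ^ h)))"
    unfolding * by (rule sum.swap)
  also have "\<dots> = (\<Sum>z\<in>UNIV. chi m (?f z) * (\<Sum>y\<in>UNIV. chi m (?L z * y)))"
    by (simp only: reindex sum_distrib_left[symmetric])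
  also have "\<dots> = (\<Sum>z\<in>UNIV. if z \<in> weil_radical h a then 2 ^ m * chi m (?f z) else 0)"
    unfolding sum_chi_mult[OF card_UNIV] weil_radical_def by (intro sum.cong) simp_all
  also have "\<dots> = (\<Sum>z\<in>weil_radical h a. 2 ^ m * chi m (?f z))"
    by (simp only: sum.If_cases finite) simp
  finally show ?thesis by (simp only: sum_distrib_left)
qed

text \<open>The substitution of \<open>x / c\<close> for \<open>x\<close> reduces every nonzero
  \<open>n\<close>-th power as leading coefficient to 1, at the price of a changed linear
  coefficient.\<close>

lemma weil_sum_scale:
  fixes b c :: 'a
  assumes "c \<noteq> 0"
  shows "weil_sum m n (c ^ n) b = weil_sum m n 1 (b / c)"
proof -
  have "bij (\<lambda>x. x / c)"
    by (rule bij_betw_byWitness[where f' = "\<lambda>x. x * c"]) (use assms in auto)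
  from sum.reindex_bij_betw[OF this, of "\<lambda>x. chi m (c ^ n * x ^ n + b * x)"]
  show ?thesis using assms by (simp add: weil_sum_def power_divide)
qed

text \<open>Summing over \<open>b\<close> first, orthogonality keeps only \<open>x = 0\<close>. The
  factor with \<open>0 ^ n\<close> covers \<open>n = 0\<close>, where the leading term does not
  vanish at \<open>x = 0\<close>.\<close>

lemma sum_weil_sum_linear: "(\<Sum>b\<in>UNIV. weil_sum m n (a::'a) b) = 2 ^ m * chi m (a * 0 ^ n)"
proof -
  have "(\<Sum>b\<in>UNIV. weil_sum m n a b)
      = (\<Sum>x\<in>UNIV. chi m (a * x ^ n) * (\<Sum>b\<in>UNIV. chi m (x * b)))"
    unfolding weil_sum_def
    by (subst sum.swap) (simp add: chi_add[OF card_UNIV] sum_distrib_left mult.commute)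
  also have "\<dots> = (\<Sum>x\<in>(UNIV::'a set). if x = 0 then 2 ^ m * chi m (a * 0 ^ n) else 0)"
    unfolding sum_chi_mult[OF card_UNIV] by (intro sum.cong) auto
  finally show ?thesis by simp
qed

lemma sum_weil_sum_leading:
  assumes "n > 0"
  shows "(\<Sum>a\<in>UNIV. weil_sum m n a (b::'a)) = 2 ^ m"
proof -
  have "(\<Sum>a\<in>UNIV. weil_sum m n a b)
      = (\<Sum>x\<in>UNIV. chi m (b * x) * (\<Sum>a\<in>UNIV. chi m (x ^ n * a)))"
    unfolding weil_sum_def
    by (subst sum.swap) (simp add: chi_add[OF card_UNIV] sum_distrib_left mult.commute)
  also have "\<dots> = (\<Sum>x\<in>(UNIV::'a set). if x = 0 then 2 ^ m else 0)"
    unfolding sum_chi_mult[OF card_UNIV]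
    using assms by (intro sum.cong) (auto simp: chi_zero[OF card_UNIV])
  finally show ?thesis by simp
qed

lemma weil_sum_zero_zero: "weil_sum m n (0::'a) 0 = 2 ^ m"
  by (simp add: weil_sum_def chi_zero[OF card_UNIV] card_UNIV)

lemma weil_sum_zero_nonzero: "b \<noteq> 0 \<Longrightarrow> weil_sum m n (0::'a) b = 0"
  by (simp add: weil_sum_def sum_chi_mult[OF card_UNIV])

lemma weil_sum_cong_one:
  assumes "n > 0" "n dvd 2 ^ m - 1"
  shows "[weil_sum m n (a::'a) 0 = 1] (mod int n)"
proof -
  have "weil_sum m n a 0 = chi m (a * 0 ^ n) + (\<Sum>x\<in>UNIV - {0}. chi m (a * x ^ n))"
    by (simp add: weil_sum_def sum.remove[of UNIV "0::'a"])
  also have "\<dots> = 1 + int n * (\<Sum>y\<in>(\<lambda>c. c ^ n) ` (UNIV - {0}). chi m (a * y))"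
    using sum_power_image_finite_field[of n "\<lambda>y. chi m (a * y)"] assms
    by (simp add: card_UNIV chi_zero[OF card_UNIV] zero_power)
  finally show ?thesis by (simp add: cong_iff_dvd_diff)
qed

text \<open>A nonzero \<open>z\<close> in the radical makes \<open>u = a * z ^ (2 ^ h + 1)\<close> a
  fixed point of the \<open>2 ^ h\<close>-th power. With \<open>v\<close> the square root of
  \<open>u\<close>, this gives \<open>u = v ^ (2 ^ h + 1)\<close>, so \<open>a\<close> would be the
  same power of \<open>v / z\<close>.\<close>

lemma weil_radical_nonpower:
  assumes "a \<notin> (\<lambda>c::'a. c ^ (2 ^ h + 1)) ` (UNIV - {0})" "a \<noteq> 0" "h > 0"
  shows "weil_radical h a = {0}"
proof -
  have False if z: "z \<in> weil_radical h a" "z \<noteq> 0" for z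
  proof -
    define u where "u = a * z ^ (2 ^ h + 1)"
    have "u \<noteq> 0" using z assms by (simp add: u_def)
    have eq: "a ^ (2 ^ h) * z ^ (2 ^ (2 * h)) = a * z"
      using z by (simp add: weil_radical_def char_two_add_eq_zero_iff[OF card_UNIV])
    have "u ^ (2 ^ h) = a ^ (2 ^ h) * z ^ (2 ^ (2 * h)) * z ^ (2 ^ h)"
      by (simp add: u_def power_mult_distrib mult_2 power_add flip: power_mult)
    also have "\<dots> = u" by (simp add: eq u_def)
    finally have u: "u ^ (2 ^ h) = u" .
    \<comment> \<open>On the subfield with \<open>2 ^ h\<close> elements the power \<open>2 ^ h + 1\<close> is squaring, so its elements are such powers.\<close>
    define v where "v = u ^ (2 ^ (h - 1))"
    have "v * v = u ^ (2 ^ h)"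
      using \<open>h > 0\<close> by (cases h) (simp_all add: v_def mult_2 power_add)
    moreover have "v ^ (2 ^ h) = (u ^ (2 ^ h)) ^ (2 ^ (h - 1))"
      by (simp add: v_def mult.commute flip: power_mult)
    ultimately have "v ^ (2 ^ h + 1) = u" using u by (simp add: v_def)
    then have "(v / z) ^ (2 ^ h + 1) = a" "v \<noteq> 0"
      using z(2) \<open>u \<noteq> 0\<close> by (auto simp: power_divide u_def)
    then have "a \<in> (\<lambda>c. c ^ (2 ^ h + 1)) ` (UNIV - {0})"
      using z(2) by (intro image_eqI[of _ _ "v / z"]) auto
    then show False using assms by simp
  qed
  then show ?thesis by (auto simp: weil_radical_def)
qed

lemma weil_radical_one: "weil_radical h (1::'a) = {z. z ^ (2 ^ (2 * h)) = z}"
  by (simp add: weil_radical_def char_two_add_eq_zero_iff[OF card_UNIV])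

lemma card_weil_radical_one:
  assumes "2 * h dvd m" "h > 0"
  shows "card (weil_radical h (1::'a)) = 2 ^ (2 * h)"
proof -
  have "weil_radical h (1::'a) = insert 0 {z. z ^ (2 ^ (2 * h) - 1) = 1}"
  proof -
    have "z ^ (2 ^ (2 * h)) = z * z ^ (2 ^ (2 * h) - 1)" for z :: 'a
      by (simp flip: power_Suc)
    then show ?thesis by (auto simp: weil_radical_one)
  qed
  moreover have "card {z::'a. z ^ (2 ^ (2 * h) - 1) = 1} = 2 ^ (2 * h) - 1"
    by (rule card_roots_of_unity_finite_field)
       (use power_minus_one_dvd[OF assms(1), of 2] card_UNIV in simp)
  \<comment> \<open>The exponent \<open>2 ^ (2 * h) - 1\<close> is thus positive, so 0 is not a root
    of unity and \<open>insert\<close> adds a new element.\<close>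
  moreover have "(1::nat) < 2 ^ (2 * h)"
    using assms(2) by (intro one_less_power) auto
  ultimately show ?thesis by (simp add: zero_power)
qed

text \<open>Removes the quadratic term from the sum over the radical, which leaves a linear
  character sum over an additive subgroup.\<close>

lemma chi_weil_radical_one:
  assumes "z \<in> weil_radical h (1::'a)" "m = 2 * e" "h dvd e"
  shows "chi m (z ^ (2 ^ h + 1)) = 1"
proof -
  define u where "u = z ^ (2 ^ h + 1)"
  have "u ^ (2 ^ h) = z ^ (2 ^ (2 * h)) * z ^ (2 ^ h)"
    by (simp add: u_def power_mult_distrib mult_2 power_add flip: power_mult)
  then have u: "u ^ (2 ^ h) = u" using assms(1) by (simp add: u_def weil_radical_one)
  obtain k where k: "e = h * k" using assms(3) by auto
  \<comment> \<open>\<open>u\<close> lies in the subfield with \<open>2 ^ e\<close> elements, so each conjugate occurs twice in its trace.\<close>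
  have ue: "u ^ (2 ^ e) = u"
    unfolding k by (induction k) (simp_all add: power_add power_mult u)
  have "(\<Sum>i<m. u ^ (2 ^ i)) = (\<Sum>i<e. u ^ (2 ^ i)) + (\<Sum>i<e. u ^ (2 ^ (e + i)))"
    using sum.atLeastLessThan_concat[of 0 e m "\<lambda>i. u ^ (2 ^ i)"]
      sum.shift_bounds_nat_ivl[of "\<lambda>i. u ^ (2 ^ i)" 0 e e] assms(2)
    by (simp add: atLeast0LessThan mult_2 add.commute)
  also have "(\<Sum>i<e. u ^ (2 ^ (e + i))) = (\<Sum>i<e. u ^ (2 ^ i))"
    by (simp add: power_add power_mult ue)
  finally have "F2_embed (abs_trace m u) = (F2_embed 0 :: 'a)"
    unfolding abs_trace_embed[OF card_UNIV] char_two_add_self[OF card_UNIV] by (simp add: F2_embed_def)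
  then show ?thesis by (simp add: chi_def u_def F2_embed_inj[OF card_UNIV])
qed

lemma weil_sum_nonpower_square:
  assumes "a \<notin> (\<lambda>c::'a. c ^ (2 ^ h + 1)) ` (UNIV - {0})" "a \<noteq> 0" "h > 0"
  shows "(weil_sum m (2 ^ h + 1) a b) ^ 2 = 2 ^ m"
  unfolding weil_sum_square weil_radical_nonpower[OF assms] by (simp add: chi_zero[OF card_UNIV])

lemma weil_sum_one_square:
  assumes "m = 2 * e" "h dvd e" "h > 0"
  shows "(weil_sum m (2 ^ h + 1) 1 (b::'a)) ^ 2 =
    (if \<forall>z\<in>weil_radical h 1. chi m (b * z) = 1 then 2 ^ (2 * (e + h)) else 0)"
proof -
  have "(weil_sum m (2 ^ h + 1) 1 b) ^ 2 = 2 ^ m * (\<Sum>z\<in>weil_radical h 1. chi m (b * z))"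
    unfolding weil_sum_square
    using chi_weil_radical_one[OF _ assms(1,2)] by (simp add: chi_add[OF card_UNIV])
  moreover have "(\<Sum>z\<in>weil_radical h 1. chi m (b * z)) =
      (if \<forall>z\<in>weil_radical h 1. chi m (b * z) = 1 then 2 ^ (2 * h) else 0)"
    using card_weil_radical_one[of h] assms
    by (subst sum_chi_mult_subgroup[OF card_UNIV])
       (auto simp: weil_radical_one char_two_power_add[OF card_UNIV] zero_power)
  ultimately show ?thesis by (simp add: assms(1) distrib_left flip: power_add)
qed

text \<open>After the square is written as a sum over the radical, summation over \<open>b\<close>
  leaves only \<open>z = 0\<close>.\<close>

lemma sum_weil_sum_one_square:
  assumes "m = 2 * e" "h dvd e" "h > 0"
  shows "(\<Sum>b\<in>UNIV. (weil_sum m (2 ^ h + 1) 1 (b::'a)) ^ 2) = 2 ^ (2 * m)"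
proof -
  have "(\<Sum>b\<in>UNIV. (weil_sum m (2 ^ h + 1) 1 (b::'a)) ^ 2)
      = 2 ^ m * (\<Sum>b\<in>UNIV. \<Sum>z\<in>weil_radical h (1::'a). chi m (z * b))"
    unfolding weil_sum_square
    using chi_weil_radical_one[OF _ assms(1,2)]
    by (simp add: chi_add[OF card_UNIV] mult.commute flip: sum_distrib_left)
  also have "\<dots> = 2 ^ m * (\<Sum>z\<in>weil_radical h (1::'a). \<Sum>b\<in>UNIV. chi m (z * b))"
    by (simp only: sum.swap[of _ UNIV])
  also have "\<dots> = 2 ^ m * 2 ^ m"
    unfolding sum_chi_mult[OF card_UNIV] by (simp add: weil_radical_one zero_power)
  finally show ?thesis by (simp add: mult_2 power_add)
qed

end

section \<open>Weights of the code\<close>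

definition codeword :: "nat \<Rightarrow> nat \<Rightarrow> 'a::finite_field \<Rightarrow> 'a \<Rightarrow> bit" where
  "codeword m h a = (\<lambda>d. if d \<in> D1 m then abs_trace m (a * d ^ (2 ^ h + 1)) else 0)"

lemma code_D1_eq: "code_D1 m h = range (codeword m h)"
  by (simp add: code_D1_def codeword_def)

lemma codeword_add:
  assumes "CARD('a::finite_field) = 2 ^ m"
  shows "codeword m h (a + b :: 'a) = codeword m h a + codeword m h b"
proof
  fix d
  show "codeword m h (a + b) d = (codeword m h a + codeword m h b) d"
    by (cases "d \<in> D1 m")
       (simp_all only: codeword_def plus_fun_apply distrib_right trace_add[OF assms] add_0_left if_True if_False)
qed

lemma codeword_zero:
  assumes "CARD('a::finite_field) = 2 ^ m"
  shows "codeword m h (0 :: 'a) = 0"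
  by (rule ext) (simp add: codeword_def trace_zero[OF assms])

text \<open>A coordinate counts when two traces are both 1, and the indicator of this is a quarter
  of \<open>(1 - chi m d) * (1 - chi m (a * d ^ n))\<close> with \<open>n = 2 ^ h + 1\<close>. The
  sum of \<open>chi m d\<close> alone vanishes.\<close>

lemma weight_codeword:
  assumes "CARD('a::finite_field) = 2 ^ m"
  shows "4 * int (hamming_weight (codeword m h (a :: 'a))) =
    2 ^ m - weil_sum m (2 ^ h + 1) a 0 + weil_sum m (2 ^ h + 1) a 1"
proof -
  let ?n = "2 ^ h + 1 :: nat"
  have "{d. codeword m h a d \<noteq> 0} = {d. abs_trace m d \<noteq> 0 \<and> abs_trace m (a * d ^ ?n) \<noteq> 0}"
    by (auto simp: codeword_def D1_def trace_zero[OF assms])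
  then have "4 * int (hamming_weight (codeword m h a))
      = (\<Sum>d\<in>UNIV. 4 * of_bool (abs_trace m d \<noteq> 0 \<and> abs_trace m (a * d ^ ?n) \<noteq> 0))"
    unfolding hamming_weight_def by (simp add: sum_of_bool_eq Int_def flip: sum_distrib_left)
  also have "\<dots> = (\<Sum>d\<in>UNIV. 1 - chi m (1 * d) - chi m (a * d ^ ?n) + chi m (a * d ^ ?n + d))"
    unfolding chi_add[OF assms] by (intro sum.cong) (auto simp: chi_def)
  also have "\<dots> = 2 ^ m - weil_sum m ?n a 0 + weil_sum m ?n a 1"
    unfolding sum.distrib sum_subtractf sum_chi_mult[OF assms]
    by (simp add: weil_sum_def assms)
  finally show ?thesis .
qed

lemma weight_count_range:
  assumes "inj f"
  shows "weight_count (range f) w = card {a. int (hamming_weight (f a)) = w}"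
proof -
  have "{v \<in> range f. int (hamming_weight v) = w} = f ` {a. int (hamming_weight (f a)) = w}" by auto
  then show ?thesis
    unfolding weight_count_def using assms by (simp add: card_image inj_on_subset)
qed

section \<open>Values of the sums and their frequencies for the parameters of the theorem\<close>

context
  fixes m h e :: nat
  assumes card_UNIV: "CARD('a::finite_field) = 2 ^ m"
    and h_pos: "h > 0" and h_dvd: "h dvd e" and m_eq: "m = 2 * e" and e_ge: "2 * h \<le> e"
begin

private abbreviation (input) "n \<equiv> 2 ^ h + 1 :: nat"
private abbreviation (input) "eps \<equiv> (-1) ^ (e div h) :: int"
private abbreviation (input) "Powers \<equiv> (\<lambda>c::'a. c ^ n) ` (UNIV - {0})"
private abbreviation (input) "W \<equiv> weil_sum m n :: 'a \<Rightarrow> 'a \<Rightarrow> int"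

lemma exponent_gt_two: "int n > 2"
  using h_pos one_less_power[of "2::int" h] by simp

lemma exponent_dvd: "n dvd 2 ^ m - 1"
proof -
  have "n dvd 2 ^ (2 * h) - 1"
  proof -
    have "(2 ^ h + 1) * (2 ^ h - 1) = (2 ^ (2 * h) - 1 :: nat)"
      by (simp add: diff_mult_distrib2 mult_2 power_add)
    then show ?thesis by (metis dvd_triv_left)
  qed
  also have "(2 ^ (2 * h) - 1 :: nat) dvd 2 ^ m - 1"
    by (rule power_minus_one_dvd) (use h_dvd m_eq in auto)
  finally show ?thesis .
qed

lemma eps_square: "eps * eps = 1"
  by (simp flip: power_mult_distrib)

lemma eps_power_square: "(eps * 2 ^ k) ^ 2 = 2 ^ (2 * k)"
proof -
  have "(eps * 2 ^ k) ^ 2 = (eps * eps) * (2 ^ k * 2 ^ k)"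
    by (simp only: power2_eq_square ac_simps)
  also have "\<dots> = 2 ^ (2 * k)" by (simp add: eps_square mult_2 power_add)
  finally show ?thesis .
qed

text \<open>Since \<open>2 ^ h\<close> is -1 modulo \<open>n\<close>, these are the signs for which
  the possible values of \<open>W a 0\<close> are 1 modulo \<open>n\<close>. The extra factor
  \<open>2 ^ h\<close> accounts for the opposite sign in the second congruence.\<close>

lemma eps_power_cong: "[eps * 2 ^ e = 1] (mod int n)" "[- eps * 2 ^ (e + h) = 1] (mod int n)"
proof -
  have "[2 ^ e = eps] (mod int n)"
    using power_multiple_cong_minus_one[of h "e div h"] h_dvd by (simp add: add.commute)
  from cong_mult[OF cong_refl[of eps] this]
  show 1: "[eps * 2 ^ e = 1] (mod int n)" by (simp only: eps_square)
  have "[-(2 ^ h) = 1] (mod int n)"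
    by (auto simp: cong_iff_dvd_diff intro: dvdI[of _ _ "-1"])
  from cong_mult[OF 1 this]
  show "[- eps * 2 ^ (e + h) = 1] (mod int n)" by (simp add: power_add mult.assoc)
qed

lemma weil_sum_cong_exponent: "[W a 0 = 1] (mod int n)"
  by (rule weil_sum_cong_one[OF card_UNIV _ exponent_dvd]) simp

text \<open>The congruence modulo \<open>n\<close> is available for \<open>b = 0\<close> only, so
  the sign is settled there and stays open for general \<open>b\<close>.\<close>

lemma weil_sum_nonpower:
  assumes "a \<notin> Powers" "a \<noteq> 0"
  shows "W a 0 = eps * 2 ^ e" "W a b = eps * 2 ^ e \<or> W a b = - eps * 2 ^ e"
proof -
  have sq: "(W a b) ^ 2 = (eps * 2 ^ e) ^ 2" for b
    using weil_sum_nonpower_square[OF card_UNIV assms h_pos]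
    by (simp only: eps_power_square) (simp only: m_eq)
  then show "W a b = eps * 2 ^ e \<or> W a b = - eps * 2 ^ e" by (simp add: power2_eq_iff)
  show "W a 0 = eps * 2 ^ e"
    by (rule int_eq_of_square_eq_cong_one[OF sq])
       (use weil_sum_cong_exponent eps_power_cong exponent_gt_two in blast)+
qed

lemma weil_sum_one_zero: "W 1 0 = - eps * 2 ^ (e + h)"
proof (rule int_eq_of_square_eq_cong_one)
  show "(W 1 0) ^ 2 = (- eps * 2 ^ (e + h)) ^ 2"
    by (simp only: weil_sum_one_square[OF card_UNIV m_eq h_dvd h_pos])
       (simp add: chi_zero[OF card_UNIV] eps_power_square)
qed (use weil_sum_cong_exponent eps_power_cong exponent_gt_two in blast)+

lemma weil_sum_one_cases: "W 1 b = eps * 2 ^ (e + h) \<or> W 1 b = - eps * 2 ^ (e + h) \<or> W 1 b = 0"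
proof -
  have "W 1 b = 0 \<or> (W 1 b) ^ 2 = (eps * 2 ^ (e + h)) ^ 2"
    using weil_sum_one_square[OF card_UNIV m_eq h_dvd h_pos, of b]
    by (simp only: eps_power_square power_eq_0_iff split: if_splits) auto
  then show ?thesis by (auto simp: power2_eq_iff)
qed

lemma weil_sum_power:
  assumes "a \<in> Powers"
  shows "W a 0 = - eps * 2 ^ (e + h)"
    "W a b = eps * 2 ^ (e + h) \<or> W a b = - eps * 2 ^ (e + h) \<or> W a b = 0"
proof -
  obtain c where "a = c ^ n" "c \<noteq> 0" using assms by blast
  then have "W a b = W 1 (b / c)" for b using weil_sum_scale[OF card_UNIV] by blast
  then show "W a 0 = - eps * 2 ^ (e + h)"
    "W a b = eps * 2 ^ (e + h) \<or> W a b = - eps * 2 ^ (e + h) \<or> W a b = 0"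
    using weil_sum_one_zero weil_sum_one_cases[of "b / c"] by simp_all
qed

lemma card_weil_sum_one:
  defines "s \<equiv> eps * 2 ^ (e + h)"
  shows "2 * int (card {b. W 1 b = s}) = 2 ^ (m - 2 * h) + eps * 2 ^ (e - h)"
    "int (card {b. W 1 b = 0}) = 2 ^ m - 2 ^ (m - 2 * h)"
proof -
  let ?p = "int (card {b. W 1 b = s})" and ?q = "int (card {b. W 1 b = - s})"
  have "s \<noteq> 0" by (simp add: s_def)
  have cases: "W 1 b = s \<or> W 1 b = - s \<or> W 1 b = 0" for b
    using weil_sum_one_cases[of b] by (simp add: s_def)
  note T = sum_three_values[where A = UNIV and g = "W 1", OF _ cases \<open>s \<noteq> 0\<close>, simplified]
  have s2: "s * s = 2 ^ (2 * (e + h))"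
    using eps_power_square[of "e + h"] by (simp add: s_def power2_eq_square)
  have "2 ^ m = s * (?p - ?q)"
    using T(1) sum_weil_sum_linear[OF card_UNIV, of n 1] by (simp add: chi_zero[OF card_UNIV])
  \<comment> \<open>Inserting \<open>eps * eps = 1\<close> splits off the factor \<open>s\<close>,
    which can then be cancelled from the first moment.\<close>
  also have "2 ^ m = (eps * eps) * 2 ^ (e + h + (e - h))"
    unfolding eps_square using e_ge m_eq by simp
  also have "\<dots> = s * (eps * 2 ^ (e - h))"
    by (simp only: s_def power_add mult.assoc mult.commute mult.left_commute)
  finally have "s * (eps * 2 ^ (e - h)) = s * (?p - ?q)" .
  then have 1: "?p - ?q = eps * 2 ^ (e - h)" using \<open>s \<noteq> 0\<close> by simp
  have "2 ^ (2 * m) = s * s * (?p + ?q)"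
    using T(2) sum_weil_sum_one_square[OF card_UNIV m_eq h_dvd h_pos] by (simp add: power2_eq_square)
  also have "(2::int) ^ (2 * m) = s * s * 2 ^ (m - 2 * h)"
    using e_ge unfolding s2 by (simp add: m_eq flip: power_add)
  finally have 2: "?p + ?q = 2 ^ (m - 2 * h)" using \<open>s \<noteq> 0\<close> by simp
  show "2 * ?p = 2 ^ (m - 2 * h) + eps * 2 ^ (e - h)" using 1 2 by linarith
  have "int (2 ^ m) = ?p + ?q + int (card {b. W 1 b = 0})"
    unfolding card_UNIV[symmetric] by (subst T(3)) simp
  then have "2 ^ m = ?p + ?q + int (card {b. W 1 b = 0})" by simp
  then show "int (card {b. W 1 b = 0}) = 2 ^ m - 2 ^ (m - 2 * h)" using 2 by linarith
qed

lemma bij_betw_inverse_nonzero: "bij_betw (\<lambda>c::'a. 1 / c) (UNIV - {0}) (UNIV - {0})"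
  by (rule bij_betw_byWitness[where f' = "\<lambda>c. 1 / c"]) auto

text \<open>Each power is \<open>c ^ n\<close> for \<open>n\<close> values of \<open>c\<close>, and
  \<open>W (c ^ n) 1 = W 1 (1 / c)\<close>. As \<open>1 / c\<close> runs over the nonzero elements
  only, \<open>b = 0\<close> must not contribute to the right-hand side.\<close>

lemma card_weil_sum_power:
  assumes "W 1 0 \<noteq> t"
  shows "n * card {a \<in> Powers. W a 1 = t} = card {b. W 1 b = t}"
proof -
  have "n * card {a \<in> Powers. W a 1 = t} = card {c. c \<noteq> 0 \<and> W (c ^ n) 1 = t}"
    by (rule card_power_image_finite_field) (use exponent_dvd card_UNIV in simp)
  also have "{c. c \<noteq> 0 \<and> W (c ^ n) 1 = t} = {c \<in> UNIV - {0}. W 1 (1 / c) = t}"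
    using weil_sum_scale[OF card_UNIV, where n = n] by auto
  also have "card \<dots> = card {b. W 1 b = t}"
    by (rule bij_betw_same_card[where f = "\<lambda>c. 1 / c"], rule bij_betw_byWitness[where f' = "\<lambda>c. 1 / c"])
       (use assms in auto)
  finally show ?thesis .
qed

lemma sum_weil_sum_power: "int n * (\<Sum>a\<in>Powers. W a 1) = 2 ^ m - W 1 0"
proof -
  have "int n * (\<Sum>a\<in>Powers. W a 1) = (\<Sum>c\<in>UNIV - {0}. W (c ^ n) 1)"
    by (rule sum_power_image_finite_field[symmetric]) (use exponent_dvd card_UNIV in simp)
  also have "\<dots> = (\<Sum>c\<in>UNIV - {0}. W 1 (1 / c))"
    using weil_sum_scale[OF card_UNIV, where n = n] by (intro sum.cong) auto
  also have "\<dots> = (\<Sum>b\<in>UNIV - {0}. W 1 b)"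
    by (rule sum.reindex_bij_betw[OF bij_betw_inverse_nonzero])
  also have "\<dots> = 2 ^ m - W 1 0"
    using sum_weil_sum_linear[OF card_UNIV, of n 1]
    by (simp add: sum_diff1 chi_zero[OF card_UNIV])
  finally show ?thesis .
qed

text \<open>Only two opposite values occur on the non-powers. Their frequencies follow from the
  number of non-powers and from the first moment over all \<open>a\<close> less its part over
  \<open>Powers\<close>.\<close>

lemma card_weil_sum_nonpower:
  "2 * int n * int (card {a \<in> UNIV - {0} - Powers. W a 1 = - eps * 2 ^ e}) = (2 ^ e - eps) * 2 ^ (e + h)"
proof -
  define r where "r = eps * 2 ^ e"
  let ?N = "UNIV - {0} - Powers"
  let ?p = "int (card {a \<in> ?N. W a 1 = r})" and ?q = "int (card {a \<in> ?N. W a 1 = - r})"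
  have "r \<noteq> 0" by (simp add: r_def)
  have r2: "r * r = 2 ^ m"
    using eps_power_square[of e] by (simp add: r_def m_eq power2_eq_square)
  have cases: "W a 1 = r \<or> W a 1 = - r" if "a \<in> ?N" for a
    using weil_sum_nonpower(2)[of a 1] that by (simp add: r_def)
  have zero: "{a \<in> ?N. W a 1 = 0} = {}" using cases \<open>r \<noteq> 0\<close> by fastforce
  note T = sum_three_values[where A = ?N and g = "\<lambda>a. W a 1" and s = r]
  have card_nonzero: "int (card (UNIV - {0::'a})) = 2 ^ m - 1"
    by (simp add: card_Diff_singleton card_UNIV of_nat_diff)
  have "int (card (UNIV - {0::'a})) = int n * int (card Powers)"
    using sum_power_image_finite_field[of n "\<lambda>_::'a. 1::int"] exponent_dvd card_UNIV by simp
  then have card_Pow: "2 ^ m - 1 = int n * int (card Powers)"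
    by (simp only: card_nonzero)
  have split: "UNIV - {0} = Powers \<union> ?N" "Powers \<inter> ?N = {}" by auto
  have "card ?N = card {a \<in> ?N. W a 1 = r} + card {a \<in> ?N. W a 1 = - r} + card {a \<in> ?N. W a 1 = 0}"
    by (rule T(3)) (use cases \<open>r \<noteq> 0\<close> in auto)
  then have card_N': "int (card ?N) = ?p + ?q"
    unfolding zero card.empty by linarith
  have "int (card (UNIV - {0::'a})) = int (card Powers) + int (card ?N)"
    by (subst split, subst card_Un_disjoint) auto
  then have card_N: "2 ^ m - 1 = int (card Powers) + (?p + ?q)"
    by (simp only: card_nonzero card_N')
  \<comment> \<open>The term at \<open>a = 0\<close> drops out because the sum with only a nonzero
    linear term is 0.\<close>
  have "2 ^ m = (\<Sum>a\<in>UNIV - {0}. W a 1)"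
    using sum_weil_sum_leading[OF card_UNIV, of n 1] weil_sum_zero_nonzero[OF card_UNIV, of 1 n]
    by (simp add: sum_diff1)
  also have "\<dots> = (\<Sum>a\<in>Powers. W a 1) + (\<Sum>a\<in>?N. W a 1)"
    by (subst split, subst sum.union_disjoint) auto
  also have "(\<Sum>a\<in>?N. W a 1) = r * (?p - ?q)"
    by (rule T(1)) (use cases \<open>r \<noteq> 0\<close> in auto)
  finally have "int n * 2 ^ m = (2 ^ m + eps * 2 ^ (e + h)) + int n * r * (?p - ?q)"
    using sum_weil_sum_power weil_sum_one_zero by (simp add: distrib_left)
  \<comment> \<open>Here \<open>n - 1 = 2 ^ h\<close> and \<open>r * r = 2 ^ m\<close>, so both
    sides contain a factor \<open>r\<close> to cancel.\<close>
  then have "r * (int n * (?p - ?q)) = r * (r * 2 ^ h - 2 ^ h)"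
    unfolding right_diff_distrib mult.assoc[symmetric] r2
    by (simp add: algebra_simps r_def power_add)
  then have diff: "int n * (?p - ?q) = r * 2 ^ h - 2 ^ h"
    using \<open>r \<noteq> 0\<close> by simp
  have sum: "int n * (?p + ?q) = 2 ^ h * 2 ^ m - 2 ^ h"
    using card_N card_Pow by (simp add: algebra_simps)
  have "2 * int n * ?q = 2 ^ h * 2 ^ m - r * 2 ^ h"
    using sum diff by (simp add: algebra_simps)
  also have "\<dots> = (2 ^ e - eps) * 2 ^ (e + h)"
    unfolding r_def m_eq mult_2 power_add by (simp add: algebra_simps)
  finally show ?thesis by (simp add: r_def)
qed

section \<open>From the sums to the weights and their frequencies\<close>

private abbreviation (input) "weight \<equiv> \<lambda>a::'a. int (hamming_weight (codeword m h a))"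
private abbreviation (input) "X \<equiv> 2 ^ (m - 2) :: int"
private abbreviation (input) "A \<equiv> eps * 2 ^ (e + h - 1)"
private abbreviation (input) "B \<equiv> eps * 2 ^ (e + h - 2)"
private abbreviation (input) "R \<equiv> eps * 2 ^ (e - 1)"

lemma power_halves:
  "4 * X = 2 ^ m" "2 * A = eps * 2 ^ (e + h)" "2 * B = A" "2 * R = eps * 2 ^ e"
proof -
  have half: "(2::int) ^ k = 2 * 2 ^ (k - 1)" if "k > 0" for k
    using that by (cases k) simp_all
  have pos: "m > 0" "m - 1 > 0" "e + h > 0" "e + h - 1 > 0" "e > 0"
    using e_ge h_pos m_eq by simp_all
  show "4 * X = 2 ^ m"
    unfolding half[OF pos(1)] half[OF pos(2)] by (simp only: diff_diff_left one_add_one)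
  show "2 * A = eps * 2 ^ (e + h)"
    unfolding half[OF pos(3)] by (rule mult.left_commute)
  show "2 * B = A"
    unfolding half[OF pos(4)] diff_diff_left one_add_one by (rule mult.left_commute)
  show "2 * R = eps * 2 ^ e"
    unfolding half[OF pos(5)] by (rule mult.left_commute)
qed

text \<open>Coinciding weights would merge their counts. The delicate case is
  \<open>eps = -1\<close>, where \<open>X + A\<close> must stay positive.\<close>

lemma weights_distinct: "distinct [0, X + A, X + B, X, X - R]"
proof -
  have pos: "X > 0" "(2::int) ^ (e + h - 1) > 0" "(2::int) ^ (e + h - 2) > 0" "(2::int) ^ (e - 1) > 0"
    by simp_all
  have e: "eps = 1 \<or> eps = -1 \<and> 2 ^ (e + h - 1) < X"
  proof (cases "even (e div h)")
    case False
    \<comment> \<open>An odd quotient that is at least 2 is at least 3, and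
      \<open>3 * h <= e\<close> gives \<open>e + h - 1 < m - 2\<close>.\<close>
    have "2 \<le> e div h" using e_ge h_pos by (simp add: less_eq_div_iff_mult_less_eq)
    then have "3 \<le> e div h" using False by (cases "e div h = 2") auto
    then have "3 * h \<le> e" using h_pos by (simp add: less_eq_div_iff_mult_less_eq)
    then have "e + h - 1 < m - 2" using m_eq h_pos by simp
    then show ?thesis using False by simp
  qed simp
  have "e + h - 1 = Suc (e + h - 2)" using h_pos e_ge by simp
  then have double: "(2::int) ^ (e + h - 1) = 2 * 2 ^ (e + h - 2)" by (simp only: power_Suc)
  have lt: "(2::int) ^ (e - 1) < X" using e_ge h_pos m_eq by simp
  have "distinct [0, x + s * a, x + s * b, x, x - s * r]"
    if "s = 1 \<or> s = -1 \<and> a < x" "x > 0" "a > 0" "b > 0" "r > 0" "a = 2 * b" "r < x" for x s a b r :: int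
    using that by auto
  from this[OF e pos double lt] show ?thesis .
qed

text \<open>The class of \<open>a\<close> fixes \<open>W a 0\<close>, and for nonzero
  \<open>a\<close> each possible value of \<open>W a 1\<close> gives one case. Weight
  \<open>X\<close> arises both from powers and from non-powers.\<close>

lemma weight_cases:
  obtains "a = 0" "weight a = 0"
  | "a \<in> Powers" "W a 1 = eps * 2 ^ (e + h)" "weight a = X + A"
  | "a \<in> Powers" "W a 1 = 0" "weight a = X + B"
  | "a \<in> Powers" "W a 1 = - eps * 2 ^ (e + h)" "weight a = X"
  | "a \<in> UNIV - {0} - Powers" "W a 1 = eps * 2 ^ e" "weight a = X"
  | "a \<in> UNIV - {0} - Powers" "W a 1 = - eps * 2 ^ e" "weight a = X - R"
proof -
  have weight: "4 * weight a = 4 * X - W a 0 + W a 1"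
    unfolding power_halves by (rule weight_codeword[OF card_UNIV])
  consider "a = 0" | "a \<in> Powers" | "a \<in> UNIV - {0} - Powers" by blast
  then show thesis
  proof cases
    case 1
    then show thesis
      using that(1) weight power_halves(1) weil_sum_zero_zero[OF card_UNIV] weil_sum_zero_nonzero[OF card_UNIV, of 1]
      by simp
  next
    case 2
    note W = weil_sum_power(1)[OF 2] weil_sum_power(2)[OF 2, of 1]
    have "- W a 0 = 2 * A" using W(1) power_halves(2) by simp
    note weight' = weight this power_halves(2,3)
    from W(2) show thesis
    proof (elim disjE)
      assume W1: "W a 1 = eps * 2 ^ (e + h)"
      moreover have "weight a = X + A" using weight' W1 by linarith
      ultimately show thesis by (rule that(2)[OF 2])
    next
      assume W1: "W a 1 = - eps * 2 ^ (e + h)"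
      moreover have "weight a = X" using weight' W1 by linarith
      ultimately show thesis by (rule that(4)[OF 2])
    next
      assume W1: "W a 1 = 0"
      moreover have "weight a = X + B" using weight' W1 by linarith
      ultimately show thesis by (rule that(3)[OF 2])
    qed
  next
    case 3
    then have "a \<notin> Powers" "a \<noteq> 0" by auto
    note W = weil_sum_nonpower(1)[OF this] weil_sum_nonpower(2)[OF this, of 1]
    have "W a 0 = 2 * R" using W(1) power_halves(4) by simp
    note weight' = weight this power_halves(4)
    from W(2) show thesis
    proof (elim disjE)
      assume W1: "W a 1 = eps * 2 ^ e"
      moreover have "weight a = X" using weight' W1 by linarith
      ultimately show thesis by (rule that(5)[OF 3])
    next
      assume W1: "W a 1 = - eps * 2 ^ e"
      moreover have "weight a = X - R" using weight' W1 by linarith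
      ultimately show thesis by (rule that(6)[OF 3])
    qed
  qed
qed

lemma weight_level_sets:
  "{a. weight a = 0} = {0}"
  "{a. weight a = X + A} = {a \<in> Powers. W a 1 = eps * 2 ^ (e + h)}"
  "{a. weight a = X + B} = {a \<in> Powers. W a 1 = 0}"
  "{a. weight a = X - R} = {a \<in> UNIV - {0} - Powers. W a 1 = - eps * 2 ^ e}"
proof -
  \<comment> \<open>From here on only the distinctness of the five weights and the facts
    \<open>ne\<close> matter, so the formulas are hidden behind names.\<close>
  define P s r where "P = Powers" and "s = eps * 2 ^ (e + h)" and "r = eps * 2 ^ e"
  have ne: "s \<noteq> 0" "r \<noteq> 0" "0 \<notin> P" by (auto simp: s_def r_def P_def)
  have neg: "- eps * 2 ^ (e + h) = - s" "- eps * 2 ^ e = - r" by (simp_all add: s_def r_def)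
  define w v1 v2 v3 v4 where "w = weight" and "v1 = X + A" and "v2 = X + B" and "v3 = X" and "v4 = X - R"
  have "distinct [0, v1, v2, v3, v4]"
    unfolding v1_def v2_def v3_def v4_def by (rule weights_distinct)
  note D = this[simplified]
  have w: "weight y = w y" for y by (simp add: w_def)
  note defs = w P_def[symmetric] v1_def[symmetric] v2_def[symmetric] v4_def[symmetric]
    neg s_def[symmetric] r_def[symmetric]
  have *: "(w y = 0 \<longleftrightarrow> y = 0) \<and> (w y = v1 \<longleftrightarrow> y \<in> P \<and> W y 1 = s) \<and> (w y = v2 \<longleftrightarrow> y \<in> P \<and> W y 1 = 0)
    \<and> (w y = v4 \<longleftrightarrow> y \<in> UNIV - {0} - P \<and> W y 1 = - r)" for y
    by (rule weight_cases[of y, unfolded defs, folded v3_def]) (use D ne in auto)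
  show "{a. weight a = 0} = {0}"
    "{a. weight a = X + A} = {a \<in> Powers. W a 1 = eps * 2 ^ (e + h)}"
    "{a. weight a = X + B} = {a \<in> Powers. W a 1 = 0}"
    "{a. weight a = X - R} = {a \<in> UNIV - {0} - Powers. W a 1 = - eps * 2 ^ e}"
    unfolding defs using * by blast+
qed

text \<open>In characteristic two \<open>a + b\<close> is the difference, and only 0 gives a word of
  weight 0. Codewords can therefore be counted by their field elements.\<close>

lemma inj_codeword: "inj (codeword m h :: 'a \<Rightarrow> _)"
proof (rule injI)
  fix a b :: 'a assume eq: "codeword m h a = codeword m h b"
  have "codeword m h (a + b) = codeword m h (b + b)"
    unfolding codeword_add[OF card_UNIV] eq ..
  then have "weight (a + b) = 0"
    by (simp add: char_two_add_self[OF card_UNIV] codeword_zero[OF card_UNIV] hamming_weight_def)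
  then have "a + b = 0" using weight_level_sets(1) by blast
  then show "a = b" by (simp add: char_two_add_eq_zero_iff[OF card_UNIV])
qed

lemma binary_linear_code_D1: "binary_linear_code (D1 m :: 'a set) (2 ^ (m - 1)) m (code_D1 m h)"
proof -
  let ?C = "range (codeword m h :: 'a \<Rightarrow> _)"
  have "F2.subspace ?C"
  proof (rule F2.subspaceI)
    show zero: "0 \<in> ?C" using codeword_zero[OF card_UNIV] by (metis rangeI)
    show "x + y \<in> ?C" if "x \<in> ?C" "y \<in> ?C" for x y
      using that by (auto simp flip: codeword_add[OF card_UNIV])
    show "F2_scale c x \<in> ?C" if "x \<in> ?C" for c x
      using that zero by (cases c) simp_all
  qed
  moreover have "F2.dim ?C = m"
    by (rule F2_dim_eqI)
       (use \<open>F2.subspace ?C\<close> inj_codeword card_UNIV in \<open>simp_all add: card_image\<close>)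
  ultimately show ?thesis
    by (auto simp: binary_linear_code_def code_D1_eq card_D1[OF card_UNIV] F2_space_def codeword_def)
qed

lemma weight_count_D1:
  "weight_count (code_D1 m h :: ('a \<Rightarrow> bit) set) w = card {a. weight a = w}"
  unfolding code_D1_eq by (rule weight_count_range[OF inj_codeword])

lemma weight_count_zero: "weight_count (code_D1 m h :: ('a \<Rightarrow> bit) set) 0 = 1"
  unfolding weight_count_D1 weight_level_sets by simp

lemma weight_count_other:
  assumes "w \<notin> {0, X + A, X + B, X, X - R}"
  shows "weight_count (code_D1 m h :: ('a \<Rightarrow> bit) set) w = 0"
proof -
  have "weight a \<noteq> w" for a by (rule weight_cases[of a]) (use assms in auto)
  then show ?thesis by (simp add: weight_count_D1)
qed

text \<open>In terms of \<open>t\<close> and \<open>k\<close> every power of 2 involved is a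
  monomial, for instance \<open>2 ^ m = 4 * t^2 * k^2\<close>, so the counts become polynomial
  identities. Multiplying by \<open>k + 1 = n\<close> avoids division in the integers.\<close>

lemma weight_count_values:
  fixes c :: "int \<Rightarrow> int" and t k :: int
  defines "c \<equiv> \<lambda>w. int (weight_count (code_D1 m h :: ('a \<Rightarrow> bit) set) w)"
    and "t \<equiv> 2 ^ (e - h - 1)" and "k \<equiv> 2 ^ h"
  shows "(k + 1) * c (X + A) = 2 * t\<^sup>2 + eps * t"
    and "c (X + B) = (k - 1) * (4 * t\<^sup>2)"
    and "(k + 1) * c (X - R) = (2 * t * k - eps) * (t * k\<^sup>2)"
    and "c X = 2 * t\<^sup>2 * k\<^sup>2 - 1 + eps * t * (k - 1) - (k - 1) * (2 * t\<^sup>2)"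
proof -
  have "e - h = Suc (e - h - 1)" using e_ge h_pos by simp
  then have "(2::int) ^ (e - h) = 2 ^ Suc (e - h - 1)" by (rule arg_cong)
  then have eh: "2 ^ (e - h) = 2 * t" unfolding power_Suc t_def .
  have "(2::int) ^ e = 2 ^ ((e - h) + h)" using e_ge by simp
  then have e: "2 ^ e = 2 * t * k" by (simp only: power_add eh k_def)
  have "m - 2 * h = (e - h) + (e - h)" using e_ge m_eq by simp
  then have "(2::int) ^ (m - 2 * h) = 2 ^ (e - h) * 2 ^ (e - h)"
    by (simp only: power_add)
  then have mh: "2 ^ (m - 2 * h) = 4 * t\<^sup>2"
    unfolding eh by (simp add: power2_eq_square)
  have m: "2 ^ m = 4 * t\<^sup>2 * k\<^sup>2"
    unfolding m_eq mult_2[of e] power_add e by (simp add: power2_eq_square)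
  have eh': "2 ^ (e + h) = 2 * t * k\<^sup>2"
    by (simp add: power_add e k_def[symmetric] power2_eq_square)
  have n: "int n = k + 1" by (simp add: k_def)
  have "k > 0" by (simp add: k_def)
  have c: "c w = int (card {a. weight a = w})" for w
    by (simp add: c_def weight_count_D1)
  have "eps * 2 ^ (e + h) \<noteq> 0" by simp
  \<comment> \<open>The value at \<open>b = 0\<close> has the opposite sign and is nonzero, so
    \<open>card_weil_sum_power\<close> applies to both counts.\<close>
  then have W0: "W 1 0 \<noteq> eps * 2 ^ (e + h)" "W 1 0 \<noteq> 0"
    unfolding weil_sum_one_zero by linarith+
  have "2 * ((k + 1) * c (X + A)) = 2 * int (card {b. W 1 b = eps * 2 ^ (e + h)})"
    unfolding c weight_level_sets n[symmetric] card_weil_sum_power[OF W0(1), symmetric] by (simp only: of_nat_mult)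
  then show A: "(k + 1) * c (X + A) = 2 * t\<^sup>2 + eps * t"
    unfolding card_weil_sum_one mh eh by linarith
  have "(k + 1) * c (X + B) = int (card {b. W 1 b = 0})"
    unfolding c weight_level_sets n[symmetric] card_weil_sum_power[OF W0(2), symmetric] by (simp only: of_nat_mult)
  also have "\<dots> = (k + 1) * ((k - 1) * (4 * t\<^sup>2))"
    unfolding card_weil_sum_one mh m by (simp add: algebra_simps power2_eq_square)
  finally show B: "c (X + B) = (k - 1) * (4 * t\<^sup>2)" using \<open>k > 0\<close> by simp
  have "2 * ((k + 1) * c (X - R)) = (2 * t * k - eps) * (2 * t * k\<^sup>2)"
    using card_weil_sum_nonpower unfolding c weight_level_sets n e eh' by (simp only: mult.assoc)
  then show R: "(k + 1) * c (X - R) = (2 * t * k - eps) * (t * k\<^sup>2)"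
    by (simp add: algebra_simps)
  \<comment> \<open>Weight \<open>X\<close> has two sources, so its count is obtained as
    \<open>2 ^ m\<close> minus the other four.\<close>
  let ?ws = "[0, X + A, X + B, X, X - R]"
  have "weight a \<in> set ?ws" for a by (rule weight_cases[of a]) simp_all
  then have "weight ` UNIV \<subseteq> set ?ws" by (rule image_subsetI)
  from sum.group[OF finite finite_set this, of "\<lambda>_. 1 :: int"]
  have "(\<Sum>w\<in>set ?ws. c w) = (\<Sum>a\<in>(UNIV :: 'a set). 1)"
    unfolding c by (simp only: UNIV_I simp_thms sum_constant mult_1_right)
  moreover have "(\<Sum>w\<in>set ?ws. c w) = sum_list (map c ?ws)"
    by (rule sum.distinct_set_conv_list[OF weights_distinct])
  moreover have "(\<Sum>a\<in>(UNIV :: 'a set). 1) = (2 ^ m :: int)" by (simp add: card_UNIV)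
  moreover have "c 0 = 1" by (simp add: c_def weight_count_zero)
  ultimately have total: "4 * t\<^sup>2 * k\<^sup>2 = 1 + c (X + A) + c (X + B) + c X + c (X - R)"
    unfolding m by (simp only: list.map sum_list.Cons sum_list.Nil add_0_right add.assoc)
  have "(k + 1) * c X = (k + 1) * (4 * t\<^sup>2 * k\<^sup>2 - 1 - c (X + B)) - (k + 1) * c (X + A) - (k + 1) * c (X - R)"
    using total by (simp add: algebra_simps)
  also have "\<dots> = (k + 1) * (2 * t\<^sup>2 * k\<^sup>2 - 1 + eps * t * (k - 1) - (k - 1) * (2 * t\<^sup>2))"
    unfolding A B R by (simp add: algebra_simps power2_eq_square)
  finally show "c X = 2 * t\<^sup>2 * k\<^sup>2 - 1 + eps * t * (k - 1) - (k - 1) * (2 * t\<^sup>2)"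
    using \<open>k > 0\<close> by simp
qed

end

section \<open>The weight distribution with rational formulas\<close>

theorem theorem4:
  fixes m h e :: nat and C :: "('a::finite_field \<Rightarrow> bit) set"
  assumes "CARD('a) = 2 ^ m"
    and "m > 0" and "h > 0" and "h dvd m"
    and "even (m div h)" and "m div h > 2"
    and "m = 2 * e"
  defines "C \<equiv> code_D1 m h"
  shows "binary_linear_code (D1 m :: 'a set) (2 ^ (m - 1)) m C
    \<and> weight_count C 0 = 1
    \<and> real (weight_count C (2 ^ (m - 2) + (-1) ^ (e div h) * 2 ^ (e + h - 1)))
        = (2 ^ (m - 2 * h - 1) + (-1) ^ (e div h) * 2 ^ (e - h - 1)) / (2 ^ h + 1)
    \<and> real (weight_count C (2 ^ (m - 2) + (-1) ^ (e div h) * 2 ^ (e + h - 2)))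
        = (2 ^ h - 1) * 2 ^ (m - 2 * h)
    \<and> real (weight_count C (2 ^ (m - 2)))
        = 2 ^ (m - 1) - 1 + (-1) ^ (e div h) * 2 ^ (e - h - 1) * (2 ^ h - 1)
          - (2 ^ h - 1) * 2 ^ (m - 2 * h - 1)
    \<and> real (weight_count C (2 ^ (m - 2) - (-1) ^ (e div h) * 2 ^ (e - 1)))
        = (2 ^ e - (-1) ^ (e div h)) * 2 ^ (e + h - 1) / (2 ^ h + 1)
    \<and> (\<forall>w. w \<notin> {0,
            2 ^ (m - 2) + (-1) ^ (e div h) * 2 ^ (e + h - 1),
            2 ^ (m - 2) + (-1) ^ (e div h) * 2 ^ (e + h - 2),
            2 ^ (m - 2),
            2 ^ (m - 2) - (-1) ^ (e div h) * 2 ^ (e - 1)}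
          \<longrightarrow> weight_count C w = 0)"
proof -
  \<comment> \<open>The quotient is even and exceeds 2, so it is at least 4; hence \<open>h\<close>
    divides \<open>e\<close> and \<open>2 * h <= e\<close>.\<close>
  obtain k where "m div h = 2 * k" using assms(5) by (elim evenE)
  then have "m = h * (2 * k)" "k \<ge> 2"
    using dvd_mult_div_cancel[OF assms(4)] assms(6) by simp_all
  then have e: "e = h * k" using assms(7) by simp
  have h_dvd: "h dvd e" and e_ge: "2 * h \<le> e" using e \<open>k \<ge> 2\<close> by simp_all
  note ctx = assms(1,3) h_dvd assms(7) e_ge
  \<comment> \<open>These are the real counterparts of \<open>t\<close>, \<open>k\<close> and
    \<open>eps\<close> in \<open>weight_count_values\<close>; over the reals its identities can be
    divided by \<open>b + 1 = 2 ^ h + 1\<close>.\<close>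
  define t b :: real and s :: real where "t = 2 ^ (e - h - 1)" and "b = 2 ^ h" and "s = (-1) ^ (e div h)"
  have eh: "e - h = Suc (e - h - 1)" using e_ge assms(3) by simp
  have pow: "2 ^ (e - h) = 2 * t" "2 ^ e = 2 * t * b" "2 ^ (m - 2 * h) = 4 * t\<^sup>2"
    "2 ^ (m - 2 * h - 1) = 2 * t\<^sup>2" "2 ^ (m - 1) = 2 * t\<^sup>2 * b\<^sup>2" "2 ^ (e + h - 1) = t * b\<^sup>2"
  proof -
    let ?l = "e - h - 1"
    have exps: "e - h = ?l + 1" "e = ?l + 1 + h" "m - 2 * h = ?l + ?l + 2" "m - 2 * h - 1 = ?l + ?l + 1"
      "m - 1 = ?l + ?l + 1 + h + h" "e + h - 1 = ?l + h + h"
      using e_ge assms(3,7) by simp_all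
    have p: "(2::real) ^ (i + j) = 2 ^ i * 2 ^ j" for i j by (rule power_add)
    show "2 ^ (e - h) = 2 * t" by (subst exps(1)) (simp add: t_def)
    show "2 ^ (m - 2 * h) = 4 * t\<^sup>2" by (subst exps(3)) (simp add: t_def p power2_eq_square)
    show "2 ^ (m - 2 * h - 1) = 2 * t\<^sup>2" by (subst exps(4)) (simp add: t_def p power2_eq_square)
    show "2 ^ (m - 1) = 2 * t\<^sup>2 * b\<^sup>2" by (subst exps(5)) (simp add: t_def b_def p power2_eq_square)
    show "2 ^ (e + h - 1) = t * b\<^sup>2" by (subst exps(6)) (simp add: t_def b_def p power2_eq_square)
    show "2 ^ e = 2 * t * b" unfolding t_def b_def using arg_cong[OF exps(2), of "\<lambda>i. (2::real) ^ i"] by (simp only: p power_one_right ac_simps)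
  qed
  have "b + 1 > 0" by (simp add: b_def add_pos_pos)
  note counts = weight_count_values[OF ctx, folded C_def]
  note real_counts = counts[THEN arg_cong, of real_of_int, unfolded of_int_mult of_int_add of_int_diff
      of_int_minus of_int_power of_int_numeral of_int_1 of_int_of_nat_eq, folded t_def b_def s_def]
  note fold = pow t_def[symmetric] b_def[symmetric] s_def[symmetric]
  show ?thesis
  proof (intro conjI allI impI)
    show "binary_linear_code (D1 m :: 'a set) (2 ^ (m - 1)) m C"
      unfolding C_def by (rule binary_linear_code_D1[OF ctx])
    show "weight_count C 0 = 1"
      unfolding C_def by (rule weight_count_zero[OF ctx])
    show "real (weight_count C (2 ^ (m - 2) + (-1) ^ (e div h) * 2 ^ (e + h - 1)))
        = (2 ^ (m - 2 * h - 1) + (-1) ^ (e div h) * 2 ^ (e - h - 1)) / (2 ^ h + 1)"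
      using real_counts(1) \<open>b + 1 > 0\<close> unfolding fold by (simp add: field_simps)
    show "real (weight_count C (2 ^ (m - 2) + (-1) ^ (e div h) * 2 ^ (e + h - 2)))
        = (2 ^ h - 1) * 2 ^ (m - 2 * h)"
      using real_counts(2) unfolding fold by simp
    show "real (weight_count C (2 ^ (m - 2)))
        = 2 ^ (m - 1) - 1 + (-1) ^ (e div h) * 2 ^ (e - h - 1) * (2 ^ h - 1)
          - (2 ^ h - 1) * 2 ^ (m - 2 * h - 1)"
      using real_counts(4) unfolding fold by simp
    show "real (weight_count C (2 ^ (m - 2) - (-1) ^ (e div h) * 2 ^ (e - 1)))
        = (2 ^ e - (-1) ^ (e div h)) * 2 ^ (e + h - 1) / (2 ^ h + 1)"
      using real_counts(3) \<open>b + 1 > 0\<close> unfolding fold by (simp add: field_simps)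
    show "weight_count C w = 0" if "w \<notin> {0,
            2 ^ (m - 2) + (-1) ^ (e div h) * 2 ^ (e + h - 1),
            2 ^ (m - 2) + (-1) ^ (e div h) * 2 ^ (e + h - 2),
            2 ^ (m - 2),
            2 ^ (m - 2) - (-1) ^ (e div h) * 2 ^ (e - 1)}" for w
      unfolding C_def by (rule weight_count_other[OF ctx that])
  qed
qed

end
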